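(* Let $g,f\in\mathcal{F}_0$. The Riordan array with general $(n,k)$-element $$t_{n,k}=[x^{n-k}]\,g(x)f(x)^n$$ is the vertical half of the Riordan array $(g(x),xf(x))$.
   Context: All power series are formal power series in $x$ with coefficients in $\mathbb{Q}$. $\mathcal{F}_0$ is the set of series $a_0+a_1x+a_2x^2+\cdots$ with $a_0\neq 0$; $\mathcal{F}_1$ is the set of series $a_1x+a_2x^2+\cdots$ with $a_1\ne 0$. $[x^m]$ extracts the coefficient of $x^m$ (and is $0$ for $m<0$). For $u\in\mathcal{F}_0$, $v\in\mathcal{F}_1$, the Riordan array $(u,v)$ is the infinite lower-triangular matrix, indexed by $n,k\ge0$, with $(n,k)$ entry $[x^n]\,u(x)v(x)^k$. The vertical half of a lower-triangular matrix $(a_{n,k})_{n,k\ge 0}$ is the lower-triangular matrix whose $(n,k)$ entry is $a_{2n-k,n}$ for $0\le k\le n$ (and $0$ for $k>n$). *)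

theory Defs
  imports "HOL-Computational_Algebra.Formal_Power_Series"
begin

definition F0 :: "rat fps set" where
  "F0 = {u. fps_nth u 0 \<noteq> 0}"

definition F1 :: "rat fps set" where
  "F1 = {v. fps_nth v 0 = 0 \<and> fps_nth v 1 \<noteq> 0}"

text \<open>Coefficient extraction at an integer exponent, so that \<open>[x^(n-k)]\<close> vanishes
  for \<open>k > n\<close>; truncated subtraction on naturals would give the constant term instead.\<close>

definition coeff_at :: "int \<Rightarrow> rat fps \<Rightarrow> rat" where
  "coeff_at m u = (if m < 0 then 0 else fps_nth u (nat m))"

text \<open>Infinite matrices are functions of the row index and the column index.\<close>

definition lower_triangular :: "(nat \<Rightarrow> nat \<Rightarrow> rat) \<Rightarrow> bool" where
  "lower_triangular A \<longleftrightarrow> (\<forall>n k. n < k \<longrightarrow> A n k = 0)"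

definition riordan :: "rat fps \<Rightarrow> rat fps \<Rightarrow> nat \<Rightarrow> nat \<Rightarrow> rat" where
  "riordan u v n k = coeff_at (int n) (u * v ^ k)"

definition is_riordan_array :: "(nat \<Rightarrow> nat \<Rightarrow> rat) \<Rightarrow> bool" where
  "is_riordan_array A \<longleftrightarrow> (\<exists>u\<in>F0. \<exists>v\<in>F1. A = riordan u v)"

definition vertical_half :: "(nat \<Rightarrow> nat \<Rightarrow> rat) \<Rightarrow> nat \<Rightarrow> nat \<Rightarrow> rat" where
  "vertical_half A n k = (if k \<le> n then A (2 * n - k) n else 0)"

lemma lower_triangular_riordan:
  assumes "v \<in> F1"
  shows "lower_triangular (riordan u v)"
  unfolding lower_triangular_def
proof (intro allI impI)
  fix n k :: nat
  assume "n < k"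
  have "fps_nth (v ^ k) i = 0" if "i < k" for i
    using startsby_zero_power_prefix[of v k] assms that by (simp add: F1_def)
  then show "riordan u v n k = 0"
    using \<open>n < k\<close> by (auto simp: riordan_def coeff_at_def fps_mult_nth intro!: sum.neutral)
qed

lemma X_mult_in_F1: "f \<in> F0 \<Longrightarrow> fps_X * f \<in> F1"
  by (simp add: F0_def F1_def)

end

theory Submission
  imports Defs
begin

text \<open>
  Comparing coefficients identifies \<open>t\<close> with the vertical half. For the Riordan property, let
  \<open>v = x p\<close> be the compositional inverse of \<open>x / f\<close>, so that \<open>f(v) = p\<close>. Lagrange inversion gives
  \<open>[x\<^sup>n] h f\<^sup>n = [x\<^sup>n] h(v) v' / p\<close> for every \<open>h\<close>; taking \<open>h = x\<^sup>k g\<close> shows that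
  \<open>t\<close> is the Riordan array \<open>(g(v) v' / p, v)\<close>.
\<close>

text \<open>As \<open>b ^ j\<close> has order at least \<open>j\<close>, all inner sums can be
  extended to the common bound \<open>n\<close>. They then no longer depend on \<open>i\<close>, and
  the two sums can be swapped.\<close>

lemma fps_compose_mult_nth:
  fixes a b c :: "'a::comm_ring_1 fps"
  assumes "fps_nth b 0 = 0"
  shows "fps_nth ((a oo b) * c) n = (\<Sum>j\<le>n. fps_nth a j * fps_nth (b ^ j * c) n)"
proof -
  have compose: "fps_nth (a oo b) i = (\<Sum>j\<le>n. fps_nth a j * fps_nth (b ^ j) i)" if "i \<le> n" for i
    unfolding fps_compose_nth atLeast0AtMost
    using that startsby_zero_power_prefix[OF assms]
    by (intro sum.mono_neutral_left) auto
  have "fps_nth ((a oo b) * c) n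
      = (\<Sum>i\<le>n. \<Sum>j\<le>n. fps_nth a j * (fps_nth (b ^ j) i * fps_nth c (n - i)))"
    by (simp add: fps_mult_nth atLeast0AtMost compose sum_distrib_right mult.assoc)
  also have "\<dots> = (\<Sum>j\<le>n. fps_nth a j * fps_nth (b ^ j * c) n)"
    by (subst sum.swap) (simp add: fps_mult_nth atLeast0AtMost sum_distrib_left)
  finally show ?thesis .
qed

text \<open>This is the residue of \<open>v' / v\<^sup>m\<^sup>+\<^sup>1\<close> for \<open>v = x p\<close>.\<close>

lemma fps_deriv_mult_inverse_power_nth:
  fixes p :: "'a::field_char_0 fps"
  assumes "fps_nth p 0 \<noteq> 0"
  shows "fps_nth (fps_deriv (fps_X * p) * inverse p ^ Suc m) m = (if m = 0 then 1 else 0)"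
proof (cases m)
  case 0
  then show ?thesis using assms by simp
next
  case (Suc l)
  define q where "q = inverse p"
  have pq: "p * q = 1"
    using assms by (simp add: q_def inverse_mult_eq_1')
  have "fps_deriv (p * q) = 0"
    unfolding pq by simp
  then have deriv: "fps_deriv p * q = - (p * fps_deriv q)"
    by (simp add: algebra_simps eq_neg_iff_add_eq_0)
  \<comment> \<open>The factors are grouped so that \<open>p * q = 1\<close> and its derivative
    eliminate \<open>p\<close>, leaving \<open>q\<close> and its derivative only.\<close>
  have "fps_deriv (fps_X * p) * q ^ Suc m
      = (p * q) * q ^ m + fps_X * ((fps_deriv p * q) * (q * q ^ l))"
    by (simp add: Suc algebra_simps)
  also have "(fps_deriv p * q) * (q * q ^ l) = - (fps_deriv q * q ^ l) * (p * q)"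
    unfolding deriv by (simp add: algebra_simps)
  finally have split: "fps_deriv (fps_X * p) * q ^ Suc m
      = q ^ m - fps_X * (fps_deriv q * q ^ l)"
    by (simp add: pq)
  \<comment> \<open>Both sides are the coefficient of the derivative of \<open>q ^ m\<close>.
    Cancelling \<open>m\<close>, nonzero in characteristic 0, makes the two terms of
    \<open>split\<close> agree at degree \<open>m\<close>.\<close>
  have "of_nat m * fps_nth (fps_deriv q * q ^ l) l = fps_nth (fps_deriv (q ^ m)) l"
    by (simp add: Suc fps_deriv_power mult.assoc del: fps_deriv_nth power_Suc of_nat_Suc)
  also have "\<dots> = of_nat m * fps_nth (q ^ m) m"
    by (simp only: fps_deriv_nth Suc Suc_eq_plus1)
  finally have "fps_nth (fps_deriv q * q ^ l) l = fps_nth (q ^ m) m"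
    using Suc by (simp del: of_nat_Suc)
  then show ?thesis
    using split Suc unfolding q_def by simp
qed

text \<open>With \<open>v = fps_X * p\<close>, the hypothesis \<open>f\<close> says that
  \<open>v\<close> inverts \<open>x / f\<close>. Expanding \<open>(h * f ^ n) oo v\<close> in powers
  of \<open>v\<close> leaves one residue for each \<open>j\<close>, and only \<open>j = n\<close>
  survives.\<close>

theorem fps_lagrange_nth:
  fixes f h p :: "'a::field_char_0 fps"
  assumes p0: "fps_nth p 0 \<noteq> 0" and f: "f oo (fps_X * p) = p"
  shows "fps_nth (h * f ^ n) n
       = fps_nth ((h oo (fps_X * p)) * (fps_deriv (fps_X * p) * inverse p)) n"
proof -
  define v where "v = fps_X * p"
  define q where "q = inverse p"
  define d where "d = fps_deriv v"
  have v0: "fps_nth v 0 = 0" by (simp add: v_def)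
  have pq: "p ^ i * q ^ i = 1" for i
    using p0 by (simp add: q_def inverse_mult_eq_1' flip: power_mult_distrib)
  have "(h * f ^ n) oo v = (h oo v) * p ^ n"
    using f by (simp add: fps_compose_mult_distrib[OF v0] flip: v_def fps_compose_power[OF v0])
  then have "(h oo v) * (d * q) = ((h * f ^ n) oo v) * (d * q ^ Suc n)"
    using pq[of n] by (simp add: algebra_simps)
  then have "fps_nth ((h oo v) * (d * q)) n
      = (\<Sum>j\<le>n. fps_nth (h * f ^ n) j * fps_nth (v ^ j * (d * q ^ Suc n)) n)"
    by (simp only: fps_compose_mult_nth[OF v0])
  also have "\<dots> = (\<Sum>j\<le>n. fps_nth (h * f ^ n) j * (if n - j = 0 then 1 else 0))"
  proof (intro sum.cong refl arg_cong2[of _ _ _ _ "(*)"])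
    fix j assume "j \<in> {..n}"
    then have j: "j \<le> n" "Suc n = j + Suc (n - j)" by auto
    \<comment> \<open>The factor \<open>p ^ j\<close> of \<open>v ^ j\<close> cancels
      \<open>j\<close> of the \<open>n + 1\<close> factors \<open>q\<close>, and
      \<open>fps_X ^ j\<close> shifts the degree to \<open>n - j\<close>: this is the residue with
      \<open>m = n - j\<close>.\<close>
    have "v ^ j * (d * q ^ Suc n) = fps_X ^ j * (p ^ j * q ^ j) * (d * q ^ Suc (n - j))"
      by (subst j(2), subst power_add) (simp add: v_def power_mult_distrib algebra_simps)
    then have "v ^ j * (d * q ^ Suc n) = fps_X ^ j * (d * q ^ Suc (n - j))"
      by (simp only: pq mult_1_right)
    then have "fps_nth (v ^ j * (d * q ^ Suc n)) n = fps_nth (d * q ^ Suc (n - j)) (n - j)"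
      using j(1) by (simp only: fps_X_power_mult_nth) simp
    then show "fps_nth (v ^ j * (d * q ^ Suc n)) n = (if n - j = 0 then 1 else 0)"
      unfolding d_def v_def q_def by (simp only: fps_deriv_mult_inverse_power_nth[OF p0])
  qed
  also have "\<dots> = (\<Sum>j\<le>n. if j = n then fps_nth (h * f ^ n) n else 0)"
    by (intro sum.cong) auto
  also have "\<dots> = fps_nth (h * f ^ n) n" by simp
  finally show ?thesis by (simp add: v_def d_def q_def)
qed

text \<open>For \<open>v\<close> the compositional inverse of \<open>x / f\<close>, the equation
  \<open>v / f(v) = x\<close> reads \<open>v = x f(v)\<close>, so \<open>p = f(v)\<close>
  works.\<close>

lemma ex_fps_compose_X_mult_eq:
  fixes f :: "'a::field fps"
  assumes "fps_nth f 0 \<noteq> 0"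
  obtains p where "fps_nth p 0 \<noteq> 0" and "f oo (fps_X * p) = p"
proof -
  define w where "w = fps_X * inverse f"
  define v where "v = fps_inv w"
  define p where "p = f oo v"
  have v0: "fps_nth v 0 = 0" by (simp add: v_def fps_inv_def)
  have "v * (inverse f oo v) = w oo v"
    by (simp add: w_def fps_compose_mult_distrib[OF v0] v0)
  also have "\<dots> = fps_X"
    using assms unfolding v_def by (intro fps_inv_right) (auto simp: w_def)
  finally have "v * ((inverse f * f) oo v) = fps_X * p"
    by (simp add: fps_compose_mult_distrib[OF v0] p_def flip: mult.assoc)
  then have "v = fps_X * p"
    using assms by (simp add: inverse_mult_eq_1)
  then have "f oo (fps_X * p) = p" by (simp add: p_def)
  moreover have "fps_nth p 0 \<noteq> 0" using assms by (simp add: p_def)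
  ultimately show thesis using that by blast
qed

text \<open>Moving \<open>k\<close> into the series leaves the degree \<open>n\<close> equal to the
  exponent of \<open>f\<close>, as Lagrange inversion requires. For \<open>k > n\<close> both sides
  are 0.\<close>

lemma coeff_at_diff:
  "coeff_at (int n - int k) u = fps_nth (fps_X ^ k * u) n"
  by (auto simp: coeff_at_def fps_X_power_mult_nth nat_diff_distrib)

theorem proposition8:
  fixes g f :: "rat fps" and t :: "nat \<Rightarrow> nat \<Rightarrow> rat"
  assumes "g \<in> F0" and "f \<in> F0"
    and "\<And>n k. t n k = coeff_at (int n - int k) (g * f ^ n)"
  shows "is_riordan_array t \<and> t = vertical_half (riordan g (fps_X * f))"
proof
  obtain p where p0: "fps_nth p 0 \<noteq> 0" and p: "f oo (fps_X * p) = p"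
    using assms(2) ex_fps_compose_X_mult_eq[of f] by (auto simp: F0_def)
  define v where "v = fps_X * p"
  define u where "u = (g oo v) * (fps_deriv v * inverse p)"
  have v0: "fps_nth v 0 = 0" by (simp add: v_def)
  have "t n k = riordan u v n k" for n k
  proof -
    have "t n k = fps_nth ((fps_X ^ k * g) * f ^ n) n"
      by (simp add: assms(3) coeff_at_diff mult.assoc)
    also have "\<dots> = fps_nth (((fps_X ^ k * g) oo v) * (fps_deriv v * inverse p)) n"
      unfolding v_def by (rule fps_lagrange_nth[OF p0 p])
    \<comment> \<open>Composition turns \<open>fps_X ^ k\<close> into \<open>v ^ k\<close>, the only
      factor that depends on \<open>k\<close>.\<close>
    also have "((fps_X ^ k * g) oo v) * (fps_deriv v * inverse p) = u * v ^ k"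
      by (simp add: u_def fps_compose_mult_distrib[OF v0] fps_X_power_compose[OF v0] mult_ac)
    finally show ?thesis by (simp add: riordan_def coeff_at_def)
  qed
  \<comment> \<open>The constant terms of \<open>fps_deriv v\<close> and \<open>inverse p\<close>
    cancel, so \<open>u\<close> has that of \<open>g\<close>.\<close>
  moreover have "u \<in> F0"
    using assms(1) p0 by (simp add: F0_def u_def v_def)
  moreover have "v \<in> F1"
    using p0 by (simp add: F1_def v_def)
  ultimately show "is_riordan_array t"
    unfolding is_riordan_array_def by blast
next
  have "t n k = vertical_half (riordan g (fps_X * f)) n k" for n k
  proof (cases "k \<le> n")
    case True
    have "riordan g (fps_X * f) (2 * n - k) n = fps_nth (fps_X ^ n * (g * f ^ n)) (2 * n - k)"
      by (simp add: riordan_def coeff_at_def power_mult_distrib mult_ac)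
    \<comment> \<open>Here \<open>k \<le> n\<close> gives \<open>2 * n - k \<ge> n\<close>, so the
      shift by \<open>fps_X ^ n\<close> does not truncate.\<close>
    also have "\<dots> = fps_nth (g * f ^ n) (n - k)"
      using True by (simp add: fps_X_power_mult_nth mult_2)
    finally show ?thesis
      using True by (simp add: vertical_half_def assms(3) coeff_at_diff fps_X_power_mult_nth)
  qed (simp add: vertical_half_def assms(3) coeff_at_def)
  then show "t = vertical_half (riordan g (fps_X * f))" by blast
qed

end
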